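(* For all integers $n\ge k\ge 0$, $$H_{\lambda}^{Y}(n,k)=\sum_{l=k}^{n}{l \brace k}_{Y}{n \brack l}\lambda^{n-l}.$$
   Context: Let $Y$ be a real random variable with $E[|Y|^{n}]<\infty$ for all integers $n\ge 0$ and $\lim_{n\to\infty}|t|^{n}E[|Y|^{n}]/n!=0$ for $|t|<r$, for some $r>0$. Let $Y_1,Y_2,\dots$ be i.i.d. copies of $Y$, $S_0=0$ and $S_k=Y_1+\cdots+Y_k$. Fix a nonzero real $\lambda$. Put $\langle x\rangle_{0,\lambda}=1$, $\langle x\rangle_{n,\lambda}=x(x+\lambda)\cdots(x+(n-1)\lambda)$. Let $e_\lambda^{-Y}(-t)=(1-\lambda t)^{-Y/\lambda}$, so $E[e_\lambda^{-Y}(-t)]=\sum_{n\ge0}E[\langle Y\rangle_{n,\lambda}]t^n/n!$ near $t=0$. The probabilistic heterogeneous Stirling numbers of the second kind are defined by $\frac{1}{k!}(E[e_{\lambda}^{-Y}(-t)]-1)^{k}=\sum_{n\ge k}H_{\lambda}^{Y}(n,k)t^{n}/n!$. The probabilistic Stirling numbers of the second kind are ${n \brace k}_{Y}=\frac{1}{k!}\sum_{l=0}^{k}\binom{k}{l}(-1)^{k-l}E[S_{l}^{n}]$ (equivalently $\frac1{k!}(E[e^{Yt}]-1)^k=\sum_{n\ge k}{n\brace k}_Y t^n/n!$). The unsigned Stirling numbers of the first kind ${n\brack k}$ are defined by $\frac{1}{k!}\big(\log\frac{1}{1-t}\big)^{k}=\sum_{n\ge k}{n \brack k}\frac{t^{n}}{n!}$.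 *)

theory Defs
  imports
    "HOL-Probability.Probability"
    "HOL-Analysis.FPS_Convergence"
    "HOL-Combinatorics.Stirling"
begin

text \<open>
  The exponential generating coefficients of a function: \<open>f t = (\<Sum>n. egf_coeff f n * t ^ n / n!)\<close>
  for \<open>t\<close> near \<open>0\<close>, whenever \<open>f\<close> has a power series expansion at \<open>0\<close> (which is then unique).
\<close>
definition egf_coeff :: "(real \<Rightarrow> real) \<Rightarrow> nat \<Rightarrow> real" where
  "egf_coeff f n = fact n * fps_nth (THE F. f has_fps_expansion F) n"

lemma egf_coeff_eqI:
  assumes "f has_fps_expansion F"
  shows "egf_coeff f n = fact n * fps_nth F n"
proof -
  have unique: "fps_nth G m = fps_nth F m" if "f has_fps_expansion F" "f has_fps_expansion G" for f :: "real \<Rightarrow> real" and G F m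
    using that
  proof (induction m arbitrary: f F G)
    case 0
    have "fps_nth H 0 = f 0" if "f has_fps_expansion H" for H
    proof -
      have "eventually (\<lambda>z. eval_fps H z = f z) (nhds 0)"
        using that by (simp add: has_fps_expansion_def)
      then have "eval_fps H 0 = f 0"
        by (rule eventually_nhds_x_imp_x)
      then show ?thesis
        by (simp add: eval_fps_at_0)
    qed
    with 0 show ?case
      by simp
  next
    case (Suc m)
    have "fps_nth (fps_deriv G) m = fps_nth (fps_deriv F) m"
      by (rule Suc.IH[OF has_fps_expansion_deriv has_fps_expansion_deriv]) (rule Suc.prems)+
    then show ?case
      by (simp del: of_nat_Suc)
  qed
  have "G = F" if "f has_fps_expansion G" for G
    by (rule fps_ext) (rule unique[OF assms that])
  with assms have "(THE F. f has_fps_expansion F) = F"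
    by (rule the_equality)
  then show ?thesis
    by (simp add: egf_coeff_def)
qed

definition degenerate_exp :: "real \<Rightarrow> real \<Rightarrow> real \<Rightarrow> real" where
  "degenerate_exp lam x t = (1 + lam * t) powr (x / lam)"

definition prob_het_Stirling :: "'a measure \<Rightarrow> ('a \<Rightarrow> real) \<Rightarrow> real \<Rightarrow> nat \<Rightarrow> nat \<Rightarrow> real" where
  "prob_het_Stirling M Y lam n k =
     egf_coeff (\<lambda>t. 1 / fact k *
       (prob_space.expectation M (\<lambda>\<omega>. degenerate_exp lam (- Y \<omega>) (- t)) - 1) ^ k) n"

text \<open>The sequence \<open>Ys\<close> of copies of \<open>Y\<close> is indexed from \<open>1\<close>; \<open>Ys 0\<close> plays no role.\<close>
definition partial_sum :: "(nat \<Rightarrow> 'a \<Rightarrow> real) \<Rightarrow> nat \<Rightarrow> 'a \<Rightarrow> real" where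
  "partial_sum Ys k \<omega> = (\<Sum>i=1..k. Ys i \<omega>)"

definition prob_Stirling :: "'a measure \<Rightarrow> (nat \<Rightarrow> 'a \<Rightarrow> real) \<Rightarrow> nat \<Rightarrow> nat \<Rightarrow> real" where
  "prob_Stirling M Ys n k =
     1 / fact k * (\<Sum>l=0..k. real (k choose l) * (- 1) ^ (k - l) *
       prob_space.expectation M (\<lambda>\<omega>. partial_sum Ys l \<omega> ^ n))"

definition iid_copies :: "'a measure \<Rightarrow> ('a \<Rightarrow> real) \<Rightarrow> (nat \<Rightarrow> 'a \<Rightarrow> real) \<Rightarrow> bool" where
  "iid_copies M Y Ys \<longleftrightarrow>
     prob_space.indep_vars M (\<lambda>_. borel) Ys {1..} \<and>
     (\<forall>i\<ge>1. distr M borel (Ys i) = distr M borel Y)"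

text \<open>
  The library's \<open>stirling\<close>, defined by its recurrence, satisfies the generating function identity
  \<open>(ln (1 / (1 - t))) ^ k / k! = (\<Sum>n. stirling n k * t ^ n / n!)\<close> defining the unsigned Stirling
  numbers of the first kind.
\<close>
lemma has_fps_expansion_ln_inverse:
  "(\<lambda>t::real. ln (1 / (1 - t))) has_fps_expansion Abs_fps (\<lambda>n. 1 / real n)" (is "_ has_fps_expansion ?L")
proof -
  have sums: "(\<lambda>n. fps_nth ?L n * t ^ n) sums ln (1 / (1 - t))" if "\<bar>t\<bar> < 1" for t :: real
  proof -
    have "(\<lambda>n. - (- ((- (- t)) ^ n) / real n)) sums - ln (1 + - t)"
      by (intro sums_minus ln_series') (use that in simp)
    moreover have "- (- ((- (- t)) ^ n) / real n) = fps_nth ?L n * t ^ n" for n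
      by simp
    moreover have "- ln (1 + - t) = ln (1 / (1 - t))"
      using that by (simp add: ln_div)
    ultimately show ?thesis
      by simp
  qed
  have "summable (\<lambda>n. fps_nth ?L n * (1 / 2) ^ n)"
    using sums[of "1 / 2"] by (intro sums_summable) auto
  then have "fps_conv_radius ?L \<ge> norm (1 / 2 :: real)"
    unfolding fps_conv_radius_def by (rule conv_radius_geI)
  then have "fps_conv_radius ?L > 0"
    by (rule less_le_trans[rotated]) simp
  moreover have "eventually (\<lambda>t. t \<in> {-1<..<1::real}) (nhds 0)"
    by (rule eventually_nhds_in_open) auto
  then have "eventually (\<lambda>t. eval_fps ?L t = ln (1 / (1 - t))) (nhds 0)"
    by eventually_elim (use sums in \<open>auto simp: eval_fps_def sums_iff abs_less_iff\<close>)
  ultimately show ?thesis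
    by (simp add: has_fps_expansion_def)
qed

lemma fps_ln_inverse_power_nth:
  "fps_nth (Abs_fps (\<lambda>n. 1 / real n) ^ k) n = fact k * real (stirling n k) / fact n"
proof (induction n arbitrary: k)
  case 0
  then show ?case
    by (cases k) (auto simp: fps_nth_power_0)
next
  case (Suc n)
  let ?L = "Abs_fps (\<lambda>n. 1 / real n)"
  show ?case
  proof (cases k)
    case 0
    then show ?thesis by simp
  next
    case (Suc j)
    have L: "(1 - fps_X) * fps_deriv ?L = 1"
    proof -
      have "fps_deriv ?L = Abs_fps (\<lambda>_. 1)"
        by (simp add: fps_eq_iff del: of_nat_Suc)
      then show ?thesis
        by (simp add: fps_eq_iff algebra_simps)
    qed
    have "(1 - fps_X) * fps_deriv (?L ^ Suc j) = of_nat (Suc j) * ?L ^ j * ((1 - fps_X) * fps_deriv ?L)"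
      unfolding fps_deriv_power' by (simp only: mult_ac diff_Suc_1)
    then have "(1 - fps_X) * fps_deriv (?L ^ Suc j) = fps_const (real (Suc j)) * ?L ^ j"
      by (simp add: L fps_of_nat del: of_nat_Suc)
    then have "fps_nth ((1 - fps_X) * fps_deriv (?L ^ Suc j)) n = real (Suc j) * fps_nth (?L ^ j) n"
      by (simp del: of_nat_Suc)
    then have "real (Suc n) * fps_nth (?L ^ Suc j) (Suc n) =
        real n * fps_nth (?L ^ Suc j) n + real (Suc j) * fps_nth (?L ^ j) n"
      by (cases n) (auto simp: left_diff_distrib simp del: of_nat_Suc power_Suc)
    also have "\<dots> = real (Suc n) * (fact (Suc j) * real (stirling (Suc n) (Suc j)) / fact (Suc n))"
      unfolding Suc.IH by (simp add: divide_simps) (simp add: algebra_simps)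
    finally show ?thesis
      unfolding \<open>k = Suc j\<close> by (simp only: mult_cancel_left of_nat_eq_0_iff nat.distinct simp_thms)
  qed
qed

lemma stirling_egf:
  "(\<lambda>t. 1 / fact k * ln (1 / (1 - t)) ^ k) has_fps_expansion Abs_fps (\<lambda>n. real (stirling n k) / fact n)"
proof -
  have "(\<lambda>t. 1 / fact k * (\<Prod>i<k. ln (1 / (1 - t)))) has_fps_expansion
      fps_const (1 / fact k) * (\<Prod>i<k. Abs_fps (\<lambda>n. 1 / real n))"
    by (intro has_fps_expansion_cmult_left has_fps_expansion_prod has_fps_expansion_ln_inverse)
  moreover have "fps_const (1 / fact k) * (\<Prod>i<k. Abs_fps (\<lambda>n. 1 / real n)) =
      Abs_fps (\<lambda>n. real (stirling n k) / fact n)"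
    by (simp add: fps_eq_iff fps_ln_inverse_power_nth)
  ultimately show ?thesis
    by simp
qed

end

theory Submission
  imports Defs "HOL-Complex_Analysis.Laurent_Convergence"
begin

text \<open>
  Near \<open>t = 0\<close> the degenerate exponential \<open>(1 - \<lambda>t)\<close> to the power \<open>-Y/\<lambda>\<close> is \<open>exp (Y u)\<close> with
  \<open>u = ln (1 / (1 - \<lambda>t)) / \<lambda>\<close>, so the generating function of the heterogeneous numbers is that of
  the probabilistic Stirling numbers composed with \<open>u\<close>. The coefficients of the powers of \<open>u\<close> are
  Stirling numbers of the first kind, and comparing coefficients gives the identity. Independence
  enters through the fact that the moments of \<open>S\<^sub>l\<close> are the coefficients of the \<open>l\<close>-th power of the
  moment generating function of \<open>Y\<close>.
\<close>

section \<open>Composition of real power series expansions via the complex numbers\<close>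

lemma fps_of_real_power:
  "Abs_fps (\<lambda>n. complex_of_real (fps_nth F n)) ^ i = Abs_fps (\<lambda>n. complex_of_real (fps_nth (F ^ i) n))"
proof (induction i)
  case (Suc i)
  then show ?case
    by (simp add: fps_eq_iff fps_mult_nth)
qed (simp add: fps_eq_iff)

lemma fps_of_real_compose:
  "fps_compose (Abs_fps (\<lambda>n. complex_of_real (fps_nth F n))) (Abs_fps (\<lambda>n. complex_of_real (fps_nth G n))) =
   Abs_fps (\<lambda>n. complex_of_real (fps_nth (fps_compose F G) n))"
  by (simp add: fps_eq_iff fps_compose_nth fps_of_real_power)

lemma fps_conv_radius_of_real:
  "fps_conv_radius (Abs_fps (\<lambda>n. complex_of_real (fps_nth F n))) = fps_conv_radius F"
  by (simp add: fps_conv_radius_def conv_radius_def)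

lemma eval_fps_of_real:
  assumes "ereal \<bar>t\<bar> < fps_conv_radius F"
  shows "eval_fps (Abs_fps (\<lambda>n. complex_of_real (fps_nth F n))) (complex_of_real t) = of_real (eval_fps F t)"
proof -
  have "summable (\<lambda>n. fps_nth F n * t ^ n)"
    using assms by (intro summable_fps) auto
  then show ?thesis
    by (simp add: eval_fps_def suminf_of_real)
qed

lemma eventually_in_fps_conv_radius:
  fixes F :: "real fps"
  assumes "fps_conv_radius F > 0"
  shows "eventually (\<lambda>t. ereal \<bar>t\<bar> < fps_conv_radius F) (nhds 0)"
proof -
  have "eventually (\<lambda>t. t \<in> eball 0 (fps_conv_radius F)) (nhds (0::real))"
    using assms by (intro eventually_nhds_in_open) (auto simp: zero_ereal_def)
  then show ?thesis
    by (simp add: in_eball_iff)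
qed

text \<open>Over the complex numbers the composite of the two convergent series is again convergent.
  Complexifying coefficients commutes with composition and preserves the radius, so restriction to
  the real axis yields both the positive radius and the values.\<close>

lemma has_fps_expansion_compose_real:
  fixes f g :: "real \<Rightarrow> real"
  assumes F: "f has_fps_expansion F" and G: "g has_fps_expansion G" and G0: "fps_nth G 0 = 0"
  shows "(\<lambda>t. f (g t)) has_fps_expansion fps_compose F G"
proof -
  let ?C = "\<lambda>H. Abs_fps (\<lambda>n. complex_of_real (fps_nth H n))"
  have radius: "fps_conv_radius F > 0" "fps_conv_radius G > 0"
    using F G by (auto simp: has_fps_expansion_def)
  have "(eval_fps (?C F) \<circ> eval_fps (?C G)) has_fps_expansion fps_compose (?C F) (?C G)"
    using radius G0
    by (intro has_fps_expansion_compose eval_fps_has_fps_expansion) (auto simp: fps_conv_radius_of_real)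
  then have radius_compose: "fps_conv_radius (fps_compose F G) > 0"
    and eval: "eventually (\<lambda>z. eval_fps (?C (fps_compose F G)) z = eval_fps (?C F) (eval_fps (?C G) z)) (nhds 0)"
    by (auto simp: has_fps_expansion_def fps_of_real_compose fps_conv_radius_of_real)
  have "filterlim complex_of_real (nhds 0) (nhds 0)"
    using tendsto_of_real[OF filterlim_ident, of 0] by simp
  then have eval_real: "eventually (\<lambda>t. eval_fps (?C (fps_compose F G)) (of_real t) =
      eval_fps (?C F) (eval_fps (?C G) (of_real t))) (nhds 0)"
    by (rule eventually_compose_filterlim[OF eval])
  \<comment> \<open>Since \<open>g\<close> is continuous and vanishes at 0, for small
    \<open>t\<close> the value \<open>g t\<close> lies inside the disc of \<open>F\<close>, where
    \<open>eval_fps F\<close> agrees with \<open>f\<close>.\<close>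
  have g0: "g 0 = 0"
    using has_fps_expansion_imp_0_eq_fps_nth_0[OF G] G0 by simp
  have "isCont g 0"
    using has_fps_expansion_imp_continuous[OF G] by simp
  then have g_lim: "filterlim g (nhds 0) (nhds 0)"
    by (metis g0 isCont_def tendsto_at_iff_tendsto_nhds)
  have eval_f: "eventually (\<lambda>x. eval_fps F x = f x) (nhds 0)"
    and eval_g: "eventually (\<lambda>t. eval_fps G t = g t) (nhds 0)"
    using F G by (auto simp: has_fps_expansion_def)
  have "eventually (\<lambda>t. eval_fps (fps_compose F G) t = f (g t)) (nhds 0)"
    using eval_real eval_g eventually_in_fps_conv_radius[OF radius(2)]
      eventually_in_fps_conv_radius[OF radius_compose]
      eventually_compose_filterlim[OF eval_f g_lim]
      eventually_compose_filterlim[OF eventually_in_fps_conv_radius[OF radius(1)] g_lim]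
  proof eventually_elim
    case (elim t)
    then have "complex_of_real (eval_fps (fps_compose F G) t) = of_real (f (g t))"
      by (simp add: eval_fps_of_real)
    then show ?case
      by (simp only: of_real_eq_iff)
  qed
  with radius_compose show ?thesis
    by (simp add: has_fps_expansion_def)
qed

lemma has_fps_expansion_power_real:
  fixes f :: "real \<Rightarrow> real"
  assumes "f has_fps_expansion F"
  shows "(\<lambda>x. f x ^ k) has_fps_expansion F ^ k"
  using has_fps_expansion_prod[of "{..<k}" "\<lambda>_. f" "\<lambda>_. F"] assms by simp

section \<open>The moment generating function and its expansion\<close>

definition moment_fps :: "'a measure \<Rightarrow> ('a \<Rightarrow> real) \<Rightarrow> real fps" where
  "moment_fps M X = Abs_fps (\<lambda>n. (\<integral>\<omega>. X \<omega> ^ n \<partial>M) / fact n)"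

text \<open>The growth condition at a point \<open>s\<close> beyond \<open>\<bar>u\<bar>\<close>
  makes the absolute series converge at \<open>u\<close>, which justifies exchanging the integral
  with the exponential series.\<close>

lemma mgf_sums:
  fixes Y :: "'a \<Rightarrow> real"
  assumes [measurable]: "Y \<in> borel_measurable M"
    and int: "\<And>m. integrable M (\<lambda>\<omega>. \<bar>Y \<omega>\<bar> ^ m)"
    and lim: "\<And>t. \<bar>t\<bar> < r \<Longrightarrow> (\<lambda>m. \<bar>t\<bar> ^ m * (\<integral>\<omega>. \<bar>Y \<omega>\<bar> ^ m \<partial>M) / fact m) \<longlonglongrightarrow> 0"
    and u: "\<bar>u\<bar> < r"
  shows "(\<lambda>m. fps_nth (moment_fps M Y) m * u ^ m) sums (\<integral>\<omega>. exp (Y \<omega> * u) \<partial>M)"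
proof -
  \<comment> \<open>The gap between \<open>\<bar>u\<bar>\<close> and \<open>s\<close> turns
    boundedness at \<open>s\<close> into summability at \<open>u\<close> by Abel's lemma.\<close>
  obtain s where s: "\<bar>u\<bar> < s" "s < r"
    using u dense by blast
  let ?a = "\<lambda>m. (\<integral>\<omega>. \<bar>Y \<omega>\<bar> ^ m \<partial>M) / fact m"
  have "(\<lambda>m. \<bar>s\<bar> ^ m * (\<integral>\<omega>. \<bar>Y \<omega>\<bar> ^ m \<partial>M) / fact m) \<longlonglongrightarrow> 0"
    using s by (intro lim) auto
  then have "Bseq (\<lambda>m. \<bar>s\<bar> ^ m * (\<integral>\<omega>. \<bar>Y \<omega>\<bar> ^ m \<partial>M) / fact m)"
    by (rule convergent_imp_Bseq[OF convergentI])
  then obtain K where "norm (\<bar>s\<bar> ^ m * (\<integral>\<omega>. \<bar>Y \<omega>\<bar> ^ m \<partial>M) / fact m) \<le> K" for m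
    by (auto simp: Bseq_def)
  then have "norm (?a m) * s ^ m \<le> K" for m
    using s by (simp add: abs_mult power_abs mult.commute)
  then have "summable (\<lambda>m. norm (?a m) * \<bar>u\<bar> ^ m)"
    using s by (intro Abel_lemma[where ?r0.0 = s]) auto
  moreover have "norm (?a m) * \<bar>u\<bar> ^ m = (\<integral>\<omega>. norm ((Y \<omega> * u) ^ m / fact m) \<partial>M)" for m
    by (simp add: abs_mult power_abs power_mult_distrib integral_nonneg_AE)
  ultimately have summable: "summable (\<lambda>m. \<integral>\<omega>. norm ((Y \<omega> * u) ^ m / fact m) \<partial>M)"
    by simp
  have "integrable M (\<lambda>\<omega>. Y \<omega> ^ m)" for m
    using int[of m] by (rule Bochner_Integration.integrable_bound) (auto simp: power_abs)
  then have integrable: "integrable M (\<lambda>\<omega>. (Y \<omega> * u) ^ m / fact m)" for m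
    by (simp add: power_mult_distrib)
  have exp_sums: "(\<lambda>m. x ^ m / fact m) sums exp x" for x :: real
    using exp_converges[of x] by (simp add: divide_inverse mult.commute)
  have "(\<lambda>m. \<integral>\<omega>. (Y \<omega> * u) ^ m / fact m \<partial>M) sums (\<integral>\<omega>. (\<Sum>m. (Y \<omega> * u) ^ m / fact m) \<partial>M)"
  proof (rule sums_integral[OF integrable _ summable])
    have "norm (x ^ m / fact m) = \<bar>x\<bar> ^ m / fact m" for x :: real and m
      by (simp add: power_abs)
    then show "AE \<omega> in M. summable (\<lambda>m. norm ((Y \<omega> * u) ^ m / fact m))"
      using sums_summable[OF exp_sums] by simp
  qed
  then show ?thesis
    by (simp add: sums_unique[OF exp_sums, symmetric]) (simp add: moment_fps_def power_mult_distrib)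
qed

lemma mgf_has_fps_expansion:
  fixes Y :: "'a \<Rightarrow> real"
  assumes "Y \<in> borel_measurable M" "\<And>m. integrable M (\<lambda>\<omega>. \<bar>Y \<omega>\<bar> ^ m)" "r > 0"
    and "\<And>t. \<bar>t\<bar> < r \<Longrightarrow> (\<lambda>m. \<bar>t\<bar> ^ m * (\<integral>\<omega>. \<bar>Y \<omega>\<bar> ^ m \<partial>M) / fact m) \<longlonglongrightarrow> 0"
  shows "(\<lambda>u. \<integral>\<omega>. exp (Y \<omega> * u) \<partial>M) has_fps_expansion moment_fps M Y"
proof -
  note sums = mgf_sums[OF assms(1,2), of r, OF assms(4)]
  \<comment> \<open>One nonzero point of convergence suffices for a positive radius;
    \<open>r / 2\<close> is such a point.\<close>
  have "summable (\<lambda>m. fps_nth (moment_fps M Y) m * (r / 2) ^ m)"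
    by (rule sums_summable, rule sums) (use \<open>r > 0\<close> in auto)
  then have "fps_conv_radius (moment_fps M Y) \<ge> norm (r / 2)"
    unfolding fps_conv_radius_def by (rule conv_radius_geI)
  then have "fps_conv_radius (moment_fps M Y) > 0"
    by (rule less_le_trans[rotated]) (use \<open>r > 0\<close> in simp)
  moreover have "eventually (\<lambda>u. u \<in> {-r<..<r}) (nhds 0)"
    using \<open>r > 0\<close> by (intro eventually_nhds_in_open) auto
  then have "eventually (\<lambda>u. eval_fps (moment_fps M Y) u = (\<integral>\<omega>. exp (Y \<omega> * u) \<partial>M)) (nhds 0)"
    by eventually_elim (use sums in \<open>auto simp: eval_fps_def sums_iff abs_less_iff\<close>)
  ultimately show ?thesis
    by (simp add: has_fps_expansion_def)
qed

section \<open>Moments of sums of independent variables\<close>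

text \<open>Independence factors the mixed moments in the binomial expansion; dividing by
  \<open>fact m\<close> turns that expansion into a Cauchy product. Working with formal series
  avoids any question of convergence here.\<close>

lemma (in prob_space) moments_add_indep:
  fixes X Z :: "'a \<Rightarrow> real"
  assumes indep: "indep_var borel X borel Z"
    and X: "\<And>m. integrable M (\<lambda>\<omega>. X \<omega> ^ m)" and Z: "\<And>m. integrable M (\<lambda>\<omega>. Z \<omega> ^ m)"
  shows "integrable M (\<lambda>\<omega>. (X \<omega> + Z \<omega>) ^ n)"
    and "moment_fps M (\<lambda>\<omega>. X \<omega> + Z \<omega>) = moment_fps M X * moment_fps M Z"
proof -
  have indep_pow: "indep_var borel (\<lambda>\<omega>. X \<omega> ^ i) borel (\<lambda>\<omega>. Z \<omega> ^ j)" for i j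
    using indep_var_compose[OF indep, of "\<lambda>x. x ^ i" borel "\<lambda>x. x ^ j" borel] by (simp add: comp_def)
  note int = indep_var_integrable[OF indep_pow X Z]
  show "integrable M (\<lambda>\<omega>. (X \<omega> + Z \<omega>) ^ n)"
    by (auto simp: binomial_ring mult.assoc intro!: Bochner_Integration.integrable_sum integrable_mult_right int)
  have "fps_nth (moment_fps M (\<lambda>\<omega>. X \<omega> + Z \<omega>)) m = fps_nth (moment_fps M X * moment_fps M Z) m" for m
  proof -
    have "expectation (\<lambda>\<omega>. (X \<omega> + Z \<omega>) ^ m) =
        (\<Sum>i\<le>m. real (m choose i) * expectation (\<lambda>\<omega>. X \<omega> ^ i * Z \<omega> ^ (m - i)))"
      using int by (simp add: binomial_ring mult.assoc Bochner_Integration.integral_sum)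
    also have "\<dots> = (\<Sum>i\<le>m. real (m choose i) * (expectation (\<lambda>\<omega>. X \<omega> ^ i) * expectation (\<lambda>\<omega>. Z \<omega> ^ (m - i))))"
      by (simp add: indep_var_lebesgue_integral[OF indep_pow X Z])
    finally show ?thesis
      by (simp add: moment_fps_def fps_mult_nth sum_divide_distrib binomial_fact atLeast0AtMost)
  qed
  then show "moment_fps M (\<lambda>\<omega>. X \<omega> + Z \<omega>) = moment_fps M X * moment_fps M Z"
    by (simp add: fps_eq_iff)
qed

text \<open>Integrability is carried through the induction because \<open>moments_add_indep\<close>
  requires it of the partial sum as well.\<close>

lemma (in prob_space) moments_partial_sum:
  fixes Y :: "'a \<Rightarrow> real"
  assumes Y [measurable]: "Y \<in> borel_measurable M"
    and int: "\<And>m. integrable M (\<lambda>\<omega>. Y \<omega> ^ m)"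
    and iid: "iid_copies M Y Ys"
  shows "(\<forall>m. integrable M (\<lambda>\<omega>. partial_sum Ys l \<omega> ^ m)) \<and>
    moment_fps M (partial_sum Ys l) = moment_fps M Y ^ l"
proof (induction l)
  case 0
  \<comment> \<open>The empty sum is 0, and \<open>0 ^ 0 = 1\<close> makes its moment series the
    constant 1.\<close>
  have "expectation (\<lambda>\<omega>. partial_sum Ys 0 \<omega> ^ m) = 0 ^ m" for m
    by (simp add: partial_sum_def prob_space)
  then show ?case
    by (auto simp: partial_sum_def moment_fps_def fps_eq_iff power_0_left prob_space)
next
  case (Suc l)
  have indep: "indep_vars (\<lambda>_. borel) Ys {1..}" and distr: "distr M borel (Ys (Suc l)) = distr M borel Y"
    using iid by (auto simp: iid_copies_def)
  have [measurable]: "Ys (Suc l) \<in> borel_measurable M"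
    using indep by (auto simp: indep_vars_def)
  have int_Ys: "integrable M (\<lambda>\<omega>. Ys (Suc l) \<omega> ^ m)" for m
    using int[of m] integrable_distr_eq[of Y M borel "\<lambda>x. x ^ m"]
      integrable_distr_eq[of "Ys (Suc l)" M borel "\<lambda>x. x ^ m"] by (simp add: distr)
  have "expectation (\<lambda>\<omega>. Ys (Suc l) \<omega> ^ m) = expectation (\<lambda>\<omega>. Y \<omega> ^ m)" for m
    using integral_distr[of Y M borel "\<lambda>x. x ^ m"]
      integral_distr[of "Ys (Suc l)" M borel "\<lambda>x. x ^ m"] by (simp add: distr)
  then have fps_Ys: "moment_fps M (Ys (Suc l)) = moment_fps M Y"
    by (simp add: moment_fps_def)
  have split: "partial_sum Ys (Suc l) = (\<lambda>\<omega>. Ys (Suc l) \<omega> + partial_sum Ys l \<omega>)"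
    by (auto simp: partial_sum_def)
  \<comment> \<open>The index \<open>Suc l\<close> lies outside the block \<open>{1..l}\<close> that
    makes up the partial sum.\<close>
  have "indep_var borel (Ys (Suc l)) borel (partial_sum Ys l)"
    using indep_vars_sum[of "{1..l}" "Suc l" Ys] indep_vars_subset[OF indep, of "insert (Suc l) {1..l}"]
    by (auto simp: partial_sum_def[abs_def])
  then show ?case
    using moments_add_indep[of "Ys (Suc l)" "partial_sum Ys l"] int_Ys Suc
    by (simp add: split fps_Ys)
qed

text \<open>Reconciles the alternating sum of moments with the generating function: in the binomial
  expansion of the \<open>k\<close>-th power, each \<open>moment_fps M Y ^ l\<close> is the moment
  series of the \<open>l\<close>-th partial sum.\<close>

lemma (in prob_space) prob_Stirling_egf:
  fixes Y :: "'a \<Rightarrow> real"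
  assumes "Y \<in> borel_measurable M" "\<And>m. integrable M (\<lambda>\<omega>. Y \<omega> ^ m)" "iid_copies M Y Ys"
  shows "fps_nth (fps_const (1 / fact k) * (moment_fps M Y - 1) ^ k) n = prob_Stirling M Ys n k / fact n"
proof -
  have moments: "fps_nth (moment_fps M Y ^ l) n = expectation (\<lambda>\<omega>. partial_sum Ys l \<omega> ^ n) / fact n" for l
    using moments_partial_sum[OF assms, of l] by (metis moment_fps_def fps_nth_Abs_fps)
  have "(moment_fps M Y - 1) ^ k = (\<Sum>l\<le>k. of_nat (k choose l) * moment_fps M Y ^ l * (- 1) ^ (k - l))"
    using binomial_ring[of "moment_fps M Y" "- 1" k] by simp
  also have "\<dots> = (\<Sum>l\<le>k. fps_const (real (k choose l) * (- 1) ^ (k - l)) * moment_fps M Y ^ l)"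
    by (intro sum.cong refl) (simp add: fps_of_nat[symmetric] mult_ac flip: fps_const_mult fps_const_power fps_const_neg)
  finally have "(moment_fps M Y - 1) ^ k =
    (\<Sum>l\<le>k. fps_const (real (k choose l) * (- 1) ^ (k - l)) * moment_fps M Y ^ l)" .
  then show ?thesis
    by (simp add: prob_Stirling_def fps_sum_nth moments sum_divide_distrib atLeast0AtMost
        mult.commute[of "fact n"] del: fps_const_mult)
qed

section \<open>Substitution of the logarithm and comparison of coefficients\<close>

lemma degenerate_exp_eq_exp:
  assumes "lam * t < 1"
  shows "degenerate_exp lam (- y) (- t) = exp (y * (1 / lam * ln (1 / (1 - lam * t))))"
  \<comment> \<open>The base \<open>1 - lam * t\<close> is positive, so \<open>powr\<close> is the
    exponential of a genuine logarithm.\<close>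
  using assms by (simp add: degenerate_exp_def powr_def ln_div)

theorem theorem2p2:
  fixes M :: "'a measure" and Y :: "'a \<Rightarrow> real" and Ys :: "nat \<Rightarrow> 'a \<Rightarrow> real"
    and lam r :: real and n k :: nat
  assumes "prob_space M"
    and "Y \<in> borel_measurable M"
    and "\<And>m. integrable M (\<lambda>\<omega>. \<bar>Y \<omega>\<bar> ^ m)"
    and "r > 0"
    and "\<And>t. \<bar>t\<bar> < r \<Longrightarrow>
      (\<lambda>m. \<bar>t\<bar> ^ m * prob_space.expectation M (\<lambda>\<omega>. \<bar>Y \<omega>\<bar> ^ m) / fact m) \<longlonglongrightarrow> 0"
    and "iid_copies M Y Ys"
    and "lam \<noteq> 0"
    and "k \<le> n"
  shows "prob_het_Stirling M Y lam n k =
    (\<Sum>l=k..n. prob_Stirling M Ys l k * real (stirling n l) * lam ^ (n - l))"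
proof -
  interpret prob_space M by fact
  have int: "integrable M (\<lambda>\<omega>. Y \<omega> ^ m)" for m
    using assms(3)[of m] by (rule Bochner_Integration.integrable_bound) (use assms(2) in \<open>auto simp: power_abs\<close>)
  \<comment> \<open>The convention \<open>1 / real 0 = 0\<close> gives \<open>?L\<close> constant
    term 0, hence also \<open>?U\<close>, so \<open>?U\<close> may be substituted into
    \<open>?G\<close>.\<close>
  let ?L = "Abs_fps (\<lambda>n. 1 / real n)"
  let ?G = "fps_const (1 / fact k) * (moment_fps M Y - 1) ^ k"
  let ?U = "fps_const (1 / lam) * fps_compose ?L (fps_const lam * fps_X)"
  let ?u = "\<lambda>t. 1 / lam * ln (1 / (1 - lam * t))"
  let ?g = "\<lambda>u. 1 / fact k * (expectation (\<lambda>\<omega>. exp (Y \<omega> * u)) - 1) ^ k"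
  have "?g has_fps_expansion ?G"
    by (intro has_fps_expansion_cmult_left has_fps_expansion_power_real has_fps_expansion_diff
        has_fps_expansion_1 mgf_has_fps_expansion[OF assms(2-5)])
  moreover have "?u has_fps_expansion ?U"
    by (intro has_fps_expansion_cmult_left has_fps_expansion_compose_real[OF has_fps_expansion_ln_inverse]
        has_fps_expansion_fps_X) simp
  ultimately have expansion: "(\<lambda>t. ?g (?u t)) has_fps_expansion fps_compose ?G ?U"
    by (rule has_fps_expansion_compose_real) simp
  \<comment> \<open>The exponential form is available only where \<open>lam * t < 1\<close>; this
    holds near 0, and an expansion depends only on values near 0.\<close>
  have "((\<lambda>t. lam * t) \<longlongrightarrow> 0) (nhds 0)"
    using tendsto_mult_left[OF filterlim_ident, of lam "0::real"] by simp
  then have "eventually (\<lambda>t. lam * t < 1) (nhds 0)"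
    by (rule order_tendstoD) simp
  then have "eventually (\<lambda>t. ?g (?u t) =
      1 / fact k * (expectation (\<lambda>\<omega>. degenerate_exp lam (- Y \<omega>) (- t)) - 1) ^ k) (nhds 0)"
    by eventually_elim (simp only: degenerate_exp_eq_exp)
  then have "(\<lambda>t. 1 / fact k * (expectation (\<lambda>\<omega>. degenerate_exp lam (- Y \<omega>) (- t)) - 1) ^ k)
      has_fps_expansion fps_compose ?G ?U"
    by (rule iffD1[OF has_fps_expansion_cong[OF _ refl] expansion])
  then have "prob_het_Stirling M Y lam n k = fact n * fps_nth (fps_compose ?G ?U) n"
    unfolding prob_het_Stirling_def by (rule egf_coeff_eqI)
  also have "\<dots> = (\<Sum>l=0..n. fact n * (fps_nth ?G l * fps_nth (?U ^ l) n))"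
    by (simp only: fps_compose_nth sum_distrib_left)
  also have "\<dots> = (\<Sum>l=0..n. prob_Stirling M Ys l k * real (stirling n l) * lam ^ (n - l))"
  proof (rule sum.cong[OF refl])
    fix l assume "l \<in> {0..n}"
    \<comment> \<open>The prefactor of \<open>?U\<close> contributes \<open>(1 / lam) ^ l\<close>,
      while scaling the argument contributes \<open>lam ^ n\<close> to the coefficient of index
      \<open>n\<close>.\<close>
    have "?U ^ l = fps_const ((1 / lam) ^ l) * fps_compose (?L ^ l) (fps_const lam * fps_X)"
      by (simp add: power_mult_distrib fps_compose_power)
    then have "fps_nth (?U ^ l) n = (1 / lam) ^ l * lam ^ n * (fact l * real (stirling n l) / fact n)"
      by (simp add: fps_ln_inverse_power_nth)
    also have "(1 / lam) ^ l * lam ^ n = lam ^ (n - l)"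
      using \<open>l \<in> {0..n}\<close> \<open>lam \<noteq> 0\<close> by (simp add: power_diff power_one_over)
    finally have "fps_nth (?U ^ l) n = lam ^ (n - l) * (fact l * real (stirling n l) / fact n)" .
    then show "fact n * (fps_nth ?G l * fps_nth (?U ^ l) n) =
        prob_Stirling M Ys l k * real (stirling n l) * lam ^ (n - l)"
      by (simp only: prob_Stirling_egf[OF assms(2) int assms(6)]) simp
  qed
  also have "\<dots> = (\<Sum>l=k..n. prob_Stirling M Ys l k * real (stirling n l) * lam ^ (n - l))"
  proof (rule sum.mono_neutral_right)
    \<comment> \<open>Total mass 1 cancels the constant term, so the \<open>k\<close>-th power has
      no coefficients below index \<open>k\<close> and the terms with \<open>l < k\<close>
      vanish.\<close>
    have "fps_nth (moment_fps M Y - 1) 0 = 0"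
      by (simp add: moment_fps_def prob_space)
    then have "fps_nth ?G l = 0" if "l < k" for l
      using that startsby_zero_power_prefix[of "moment_fps M Y - 1" k] by simp
    then have "prob_Stirling M Ys l k = 0" if "l < k" for l
      using that prob_Stirling_egf[OF assms(2) int assms(6), of k l] by simp
    then show "\<forall>l\<in>{0..n} - {k..n}. prob_Stirling M Ys l k * real (stirling n l) * lam ^ (n - l) = 0"
      by auto
  qed auto
  finally show ?thesis .
qed

end
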